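(* Let $(\Omega,\mathscr{F},P)$ be a probability space, $N\ge 1$ an integer, and let $\theta\in\Theta\subseteq\mathbb{R}^m$ be the partial information vector determined by a function $\eta_m:[0,1]^{N+\binom{N}{2}}\to\mathbb{R}^m$ of the individual and pairwise event probabilities. Let $\mathscr{L}_\Theta$ be the set of all lower bounds on $P\left(\bigcup_{i=1}^N A_i\right)$ that are functions of $\theta$ only. Then a lower bound $\ell^\star\in\mathscr{L}_\Theta$ is optimal in $\mathscr{L}_\Theta$ if and only if it is achievable.
   Context: Fix a probability space $(\Omega,\mathscr{F},P)$, positive integers $N,m$, and a function $\eta_m:[0,1]^{N+\binom{N}{2}}\to\mathbb{R}^m$. For events $A_1,\dots,A_N\in\mathscr{F}$, the collection $\{A_1,\dots,A_N\}$ is said to be represented by $\theta\in\mathbb{R}^m$ if $\theta$ equals the value of $\eta_m$ at the tuple consisting of the probabilities $P(A_i)$, $1\le i\le N$, and $P(A_i\cap A_j)$, $1\le i<j\le N$. The set $\Theta\subseteq\mathbb{R}^m$ is the set of all values $\theta$ obtained this way as $A_1,\dots,A_N$ range over $\mathscr{F}$. A lower bound in $\mathscr{L}_\Theta$ is a function $\ell:\Theta\to\mathbb{R}$ such that $P\left(\bigcup_{i=1}^N A_i\right)\ge \ell(\theta)$ for every $\theta\in\Theta$ and every collection $\{A_1,\dots,A_N\}$ of events in $\mathscr{F}$ represented by $\theta$. A lower bound $\ell^\star\in\mathscr{L}_\Theta$ is optimal in $\mathscr{L}_\Theta$ if $\ell^\star(\theta)\ge \ell(\theta)$ for all $\theta\in\Theta$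 and all $\ell\in\mathscr{L}_\Theta$. A lower bound $\ell\in\mathscr{L}_\Theta$ is achievable if for every $\theta\in\Theta$, $\inf_{A_1,\dots,A_N}P\left(\bigcup_{i=1}^N A_i\right)=\ell(\theta)$, where the infimum ranges over all collections $\{A_1,\dots,A_N\}$ with $A_i\in\mathscr{F}$ that are represented by $\theta$. *)

theory Defs
  imports "HOL-Probability.Probability_Measure"
begin

text \<open>
  The coordinates of \<open>[0,1]^(N + (N choose 2))\<close> are labelled by a disjoint sum: \<open>Inl i\<close> carries
  the probability of the event \<open>A i\<close>, and \<open>Inr (i, j)\<close> with \<open>i < j\<close> that of \<open>A i \<inter> A j\<close>.
  The space \<open>\<real>^m\<close> is \<open>real ^ 'm\<close> with \<open>m = CARD('m)\<close>, which is always positive.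
\<close>

type_synonym coord = "nat + nat \<times> nat"

definition coords :: "nat \<Rightarrow> coord set" where
  "coords N = {1..N} <+> {(i, j). 1 \<le> i \<and> i < j \<and> j \<le> N}"

definition unit_cube :: "nat \<Rightarrow> (coord \<Rightarrow> real) set" where
  "unit_cube N = coords N \<rightarrow>\<^sub>E {0..1}"

definition prob_tuple :: "'a measure \<Rightarrow> nat \<Rightarrow> (nat \<Rightarrow> 'a set) \<Rightarrow> coord \<Rightarrow> real" where
  "prob_tuple M N A =
     (\<lambda>c\<in>coords N. case c of Inl i \<Rightarrow> measure M (A i) | Inr (i, j) \<Rightarrow> measure M (A i \<inter> A j))"

definition represented_by ::
  "'a measure \<Rightarrow> nat \<Rightarrow> ((coord \<Rightarrow> real) \<Rightarrow> real ^ 'm) \<Rightarrow> (nat \<Rightarrow> 'a set) \<Rightarrow> real ^ 'm \<Rightarrow> bool" where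
  "represented_by M N \<eta> A \<theta> \<longleftrightarrow> A \<in> {1..N} \<rightarrow> sets M \<and> \<theta> = \<eta> (prob_tuple M N A)"

definition Theta ::
  "'a measure \<Rightarrow> nat \<Rightarrow> ((coord \<Rightarrow> real) \<Rightarrow> real ^ 'm) \<Rightarrow> (real ^ 'm) set" where
  "Theta M N \<eta> = {\<theta>. \<exists>A. represented_by M N \<eta> A \<theta>}"

text \<open>Functions \<open>\<Theta> \<rightarrow> \<real>\<close> are functions on \<open>\<real>^m\<close> that are \<open>undefined\<close> outside \<open>\<Theta>\<close>.\<close>

definition lower_bounds ::
  "'a measure \<Rightarrow> nat \<Rightarrow> ((coord \<Rightarrow> real) \<Rightarrow> real ^ 'm) \<Rightarrow> (real ^ 'm \<Rightarrow> real) set" where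
  "lower_bounds M N \<eta> =
     {l \<in> Theta M N \<eta> \<rightarrow>\<^sub>E UNIV.
        \<forall>\<theta>\<in>Theta M N \<eta>. \<forall>A. represented_by M N \<eta> A \<theta> \<longrightarrow> measure M (\<Union>i\<in>{1..N}. A i) \<ge> l \<theta>}"

definition optimal_bound ::
  "'a measure \<Rightarrow> nat \<Rightarrow> ((coord \<Rightarrow> real) \<Rightarrow> real ^ 'm) \<Rightarrow> (real ^ 'm \<Rightarrow> real) \<Rightarrow> bool" where
  "optimal_bound M N \<eta> l' \<longleftrightarrow>
     l' \<in> lower_bounds M N \<eta> \<and>
     (\<forall>\<theta>\<in>Theta M N \<eta>. \<forall>l\<in>lower_bounds M N \<eta>. l' \<theta> \<ge> l \<theta>)"

text \<open>
  For \<open>\<theta> \<in> \<Theta>\<close> the infimum below is over a nonempty set of reals that is bounded below by \<open>0\<close>.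
\<close>

definition achievable_bound ::
  "'a measure \<Rightarrow> nat \<Rightarrow> ((coord \<Rightarrow> real) \<Rightarrow> real ^ 'm) \<Rightarrow> (real ^ 'm \<Rightarrow> real) \<Rightarrow> bool" where
  "achievable_bound M N \<eta> l \<longleftrightarrow>
     l \<in> lower_bounds M N \<eta> \<and>
     (\<forall>\<theta>\<in>Theta M N \<eta>.
        (INF A\<in>{A. represented_by M N \<eta> A \<theta>}. measure M (\<Union>i\<in>{1..N}. A i)) = l \<theta>)"

lemma (in prob_space) prob_tuple_in_unit_cube: "prob_tuple M N A \<in> unit_cube N"
  unfolding prob_tuple_def unit_cube_def by (auto split: sum.split)

end

theory Submission
  imports Defs
begin

text \<open>
  The set of lower bounds, ordered pointwise on \<open>\<Theta>\<close>, has a greatest element: the function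
  \<open>inf_union_prob\<close> that sends \<open>\<theta>\<close> to the infimum of the union probabilities of all collections
  represented by \<open>\<theta>\<close>. Every lower bound lies below it because an infimum is the greatest number
  below all these probabilities (\<open>lower_bound_le_inf_union_prob\<close>), and it is a lower bound itself
  (\<open>inf_union_prob_in_lower_bounds\<close>), since it depends on the collection through \<open>\<theta>\<close> only.
  Optimality of a bound says that it is the greatest element, achievability that it agrees with
  this infimum on \<open>\<Theta>\<close>; as greatest elements are unique, the two properties coincide.
\<close>

definition inf_union_prob ::
  "'a measure \<Rightarrow> nat \<Rightarrow> ((coord \<Rightarrow> real) \<Rightarrow> real ^ 'm) \<Rightarrow> real ^ 'm \<Rightarrow> real" where
  "inf_union_prob M N \<eta> =
     (\<lambda>\<theta>\<in>Theta M N \<eta>. INF A\<in>{A. represented_by M N \<eta> A \<theta>}. measure M (\<Union>i\<in>{1..N}. A i))"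

text \<open>
  The infimum of the empty set of reals has no order-theoretic meaning; membership of \<open>\<theta>\<close> in
  \<open>\<Theta>\<close> enters because it says that some collection represents \<open>\<theta>\<close>.
\<close>

lemma lower_bound_le_inf_union_prob:
  assumes "l \<in> lower_bounds M N \<eta>" and "\<theta> \<in> Theta M N \<eta>"
  shows "l \<theta> \<le> inf_union_prob M N \<eta> \<theta>"
proof -
  have "l \<theta> \<le> (INF A\<in>{A. represented_by M N \<eta> A \<theta>}. measure M (\<Union>i\<in>{1..N}. A i))"
  proof (rule cINF_greatest)
    show "{A. represented_by M N \<eta> A \<theta>} \<noteq> {}"
      using assms(2) by (auto simp: Theta_def)
    show "l \<theta> \<le> measure M (\<Union>i\<in>{1..N}. A i)" if "A \<in> {A. represented_by M N \<eta> A \<theta>}" for A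
      using assms that by (auto simp: lower_bounds_def)
  qed
  then show ?thesis
    using assms(2) by (simp add: inf_union_prob_def)
qed

text \<open>
  An infimum of reals bounds each member of its family only when the family is bounded below;
  here \<open>0\<close> is such a bound because measures are nonnegative.
\<close>

lemma inf_union_prob_in_lower_bounds: "inf_union_prob M N \<eta> \<in> lower_bounds M N \<eta>"
proof -
  have "inf_union_prob M N \<eta> \<theta> \<le> measure M (\<Union>i\<in>{1..N}. A i)"
    if "\<theta> \<in> Theta M N \<eta>" and "represented_by M N \<eta> A \<theta>" for \<theta> A
  proof -
    have "bdd_below ((\<lambda>A. measure M (\<Union>i\<in>{1..N}. A i)) ` {A. represented_by M N \<eta> A \<theta>})"
      by (rule bdd_belowI2[where m = 0]) (rule measure_nonneg)
    then have "(INF A\<in>{A. represented_by M N \<eta> A \<theta>}. measure M (\<Union>i\<in>{1..N}. A i))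
        \<le> measure M (\<Union>i\<in>{1..N}. A i)"
      by (rule cINF_lower) (simp add: that(2))
    then show ?thesis
      using that(1) by (simp add: inf_union_prob_def)
  qed
  moreover have "inf_union_prob M N \<eta> \<in> Theta M N \<eta> \<rightarrow>\<^sub>E UNIV"
    by (simp add: inf_union_prob_def)
  ultimately show ?thesis
    by (simp add: lower_bounds_def)
qed

theorem lemma1p4:
  fixes M :: "'a measure" and N :: nat
    and \<eta> :: "(coord \<Rightarrow> real) \<Rightarrow> real ^ 'm"
    and lstar :: "real ^ 'm \<Rightarrow> real"
  assumes "prob_space M"
    and "N \<ge> 1"
    and "\<eta> \<in> unit_cube N \<rightarrow>\<^sub>E UNIV"
    and "lstar \<in> lower_bounds M N \<eta>"
  shows "optimal_bound M N \<eta> lstar \<longleftrightarrow> achievable_bound M N \<eta> lstar"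
proof -
  have achievable_iff: "achievable_bound M N \<eta> lstar \<longleftrightarrow>
      (\<forall>\<theta>\<in>Theta M N \<eta>. inf_union_prob M N \<eta> \<theta> = lstar \<theta>)"
    using assms(4) by (simp add: achievable_bound_def inf_union_prob_def)
  show ?thesis
  proof
    assume "optimal_bound M N \<eta> lstar"
    then have "inf_union_prob M N \<eta> \<theta> \<le> lstar \<theta>" if "\<theta> \<in> Theta M N \<eta>" for \<theta>
      using that inf_union_prob_in_lower_bounds unfolding optimal_bound_def by blast
    then show "achievable_bound M N \<eta> lstar"
      unfolding achievable_iff
      using lower_bound_le_inf_union_prob[OF assms(4)] by (auto intro: antisym)
  next
    assume "achievable_bound M N \<eta> lstar"
    then show "optimal_bound M N \<eta> lstar"
      unfolding achievable_iff optimal_bound_def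
      using assms(4) lower_bound_le_inf_union_prob by metis
  qed
qed

end
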